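(* Let $\mathsf n\ge 1$ and $\mathsf m\ge 1$ be integers, $\rho\in(0,1)$, $\mathsf P_l\in[0,1)$. Consider $\mathsf n$ nodes operating under irregular repetition slotted ALOHA (IRSA) with frames of $\mathsf m$ slots, per-slot activation probability $\rho$, packet loss rate $\mathsf P_l$ and aggregate throughput $\mathsf S=\frac{\mathsf n[1-(1-\rho)^{\mathsf m}]}{\mathsf m}(1-\mathsf P_l)$. Let $\delta^{(i)}(t)$ be the current age of information of node $i$, and define the average network age of information $$\Delta_{\mathsf{irsa}}:=\frac1{\mathsf n}\sum_{i=1}^{\mathsf n}\Delta^{(i)},\qquad \Delta^{(i)}:=\lim_{t\to\infty}\frac1t\int_0^t\delta^{(i)}(\tau)\,d\tau .$$ Then, measured in slots, with probability one, $$\Delta_{\mathsf{irsa}}=\frac{\mathsf m}{2}+\frac{\mathsf n}{\mathsf S}+\left(\frac1\rho-\frac{\mathsf m(1-\rho)^{\mathsf m}}{1-(1-\rho)^{\mathsf m}}\right).$$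
   Context: Time is measured in slots of unit duration. There are $\mathsf n$ nodes sharing a channel to a common sink. At each slot every node independently becomes active with probability $\rho$ and generates an update time-stamped with the start of that slot. Under IRSA, time is divided into frames of $\mathsf m$ slots. A node that became active at least once during a frame transmits, over the next frame, only its most recently generated update (as several replicas in randomly chosen slots of the frame, decoded at the sink at the end of the frame by successive interference cancellation). There are no retransmissions. A transmitted update is decoded with probability $1-\mathsf P_l$, where $\mathsf P_l$ is the packet loss rate. The channel load is $\mathsf G=\mathsf n[1-(1-\rho)^{\mathsf m}]/\mathsf m$ and the aggregate throughput (average number of decoded packets per slot) is $\mathsf S=\mathsf G(1-\mathsf P_l)$. The current age of information of node $i$ is $\delta^{(i)}(t)=t-\sigma^{(i)}(t)$, where $\sigma^{(i)}(t)$ is the time-stamp of the last update received from node $i$ by time $t$. It grows linearly with slope 1 inside each frame $[k\mathsf m,(k+1)\mathsf m)$, i.e. $\delta^{(i)}(t)=\delta^{(i)}(\mathsf m\lfloor t/\mathsf m\rfloor)+(t-\mathsf m\lfloor t/\mathsf m\rfloor)$. At the end of each frame, independently over frames, an update of the node is delivered with probability $\xi:=[1-(1-\rho)^{\mathsf m}](1-\mathsf P_l)=\mathsf m\mathsf S/\mathsf n$. If it is delivered, the age is reset to $\mathsf m+B$, where $B\in\{1,\dots,\mathsf m\}$ is the number of slots between the generation of the update and the start of the frame in which it is sent, with probability mass function $$p_B(b)=\frac{\rho(1-\rho)^{b-1}}{1-(1-\rho)^{\mathsf m}}.$$ If it is not delivered, the age is not reset. Time $t=0$ is set right after the reception of the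 first update, so $\delta^{(i)}(0)\in\{\mathsf m+1,\dots,2\mathsf m\}$. Accordingly, for each node, $\Omega_k:=\delta^{(i)}(k\mathsf m)-(\mathsf m+1)$, $k\in\mathbb N_0$, is a Markov chain on $\mathbb N_0$ with one-step transition probabilities, for every state $u\in\mathbb N_0$: $q_{(u,v)}=\xi\,p_B(v+1)$ if $v\in\{0,\dots,\mathsf m-1\}$, $q_{(u,v)}=1-\xi$ if $v=u+\mathsf m$, and $q_{(u,v)}=0$ otherwise. *)

theory Defs
  imports "HOL-Probability.Probability"
begin

text \<open>Slot \<open>s\<close> (an integer) is the time interval \<open>[s, s + 1)\<close>; frame \<open>f\<close> is \<open>[f m, (f + 1) m)\<close>.
  Negative indices occur because updates sent in frame 0 are generated in frame \<open>- 1\<close>.\<close>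

definition frame_slots :: "nat \<Rightarrow> int \<Rightarrow> int set" where
  "frame_slots m f = {f * int m ..< (f + 1) * int m}"

text \<open>In what follows, for a single node and a single outcome, \<open>a s\<close> says that the node is active
  in slot \<open>s\<close>, \<open>d k\<close> says that a packet sent by the node in frame \<open>k\<close> is decoded (it is irrelevant
  if the node is silent in that frame), and \<open>s0\<close> is the time-stamp of the update received
  just before time 0.\<close>

definition transmits :: "nat \<Rightarrow> (int \<Rightarrow> bool) \<Rightarrow> nat \<Rightarrow> bool" where
  "transmits m a k \<longleftrightarrow> (\<exists>s \<in> frame_slots m (int k - 1). a s)"

text \<open>Time-stamp of the packet sent in frame \<open>k\<close>: the most recent update of the preceding
  frame.  Only meaningful if \<open>transmits m a k\<close>.\<close>

definition sent_stamp :: "nat \<Rightarrow> (int \<Rightarrow> bool) \<Rightarrow> nat \<Rightarrow> int" where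
  "sent_stamp m a k = Max {s \<in> frame_slots m (int k - 1). a s}"

definition delivered :: "nat \<Rightarrow> (int \<Rightarrow> bool) \<Rightarrow> (nat \<Rightarrow> bool) \<Rightarrow> nat \<Rightarrow> bool" where
  "delivered m a d k \<longleftrightarrow> transmits m a k \<and> d k"

text \<open>Decoding takes place at the end \<open>(k + 1) m\<close> of frame \<open>k\<close>.\<close>

definition received_by :: "nat \<Rightarrow> (int \<Rightarrow> bool) \<Rightarrow> (nat \<Rightarrow> bool) \<Rightarrow> real \<Rightarrow> nat set" where
  "received_by m a d t = {k. delivered m a d k \<and> real ((k + 1) * m) \<le> t}"

definition last_stamp ::
    "nat \<Rightarrow> int \<Rightarrow> (int \<Rightarrow> bool) \<Rightarrow> (nat \<Rightarrow> bool) \<Rightarrow> real \<Rightarrow> int" where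
  "last_stamp m s0 a d t =
     (if received_by m a d t = {} then s0 else sent_stamp m a (Max (received_by m a d t)))"

definition age ::
    "nat \<Rightarrow> int \<Rightarrow> (int \<Rightarrow> bool) \<Rightarrow> (nat \<Rightarrow> bool) \<Rightarrow> real \<Rightarrow> real" where
  "age m s0 a d t = t - real_of_int (last_stamp m s0 a d t)"

definition time_average :: "(real \<Rightarrow> real) \<Rightarrow> real \<Rightarrow> real" where
  "time_average f t = (1 / t) * integral {0..t} f"

definition average_age :: "(real \<Rightarrow> real) \<Rightarrow> real" where
  "average_age f = Lim at_top (time_average f)"

definition network_average_age :: "nat \<Rightarrow> (nat \<Rightarrow> real \<Rightarrow> real) \<Rightarrow> real" where
  "network_average_age n \<delta> = (1 / real n) * (\<Sum>i = 1..n. average_age (\<delta> i))"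

definition channel_load :: "nat \<Rightarrow> nat \<Rightarrow> real \<Rightarrow> real" where
  "channel_load n m \<rho> = real n * (1 - (1 - \<rho>) ^ m) / real m"

definition throughput :: "nat \<Rightarrow> nat \<Rightarrow> real \<Rightarrow> real \<Rightarrow> real" where
  "throughput n m \<rho> P\<^sub>l = channel_load n m \<rho> * (1 - P\<^sub>l)"

text \<open>\<open>D i k\<close> is the event that node \<open>i\<close>'s packet in frame \<open>k\<close> is (or, if node \<open>i\<close> is silent, would
  have been) decoded.  It is determined by the activity of the other nodes and by the replica
  placement in that frame, hence it is independent over frames and of node \<open>i\<close>'s own activity.  In
  contrast, no independence is assumed between the decoding events of different nodes, since these
  interact through collisions and interference cancellation.

  \<open>s0 i\<close> is the time-stamp of the update of node \<open>i\<close> received just before time 0: it was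
  generated in frame \<open>- 2\<close> and sent in frame \<open>- 1\<close>.\<close>

locale irsa_network = prob_space M
  for M :: "'w measure" +
  fixes n m :: nat
    and \<rho> P\<^sub>l :: real
    and A :: "nat \<Rightarrow> int \<Rightarrow> 'w \<Rightarrow> bool"
    and D :: "nat \<Rightarrow> nat \<Rightarrow> 'w \<Rightarrow> bool"
    and s0 :: "nat \<Rightarrow> 'w \<Rightarrow> int"
  assumes activity_indep:
      "indep_vars (\<lambda>_. count_space UNIV) (\<lambda>(i, s). A i s) ({1..n} \<times> {- int m..})"
    and activity_prob:
      "\<And>i s. i \<in> {1..n} \<Longrightarrow> s \<ge> - int m \<Longrightarrow> \<P>(\<omega> in M. A i s \<omega>) = \<rho>"
    and node_indep:
      "\<And>i. i \<in> {1..n} \<Longrightarrow>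
        indep_vars (\<lambda>_. count_space UNIV) (case_sum (A i) (D i)) ({- int m..} <+> UNIV)"
    and decoding_prob:
      "\<And>i k. i \<in> {1..n} \<Longrightarrow> \<P>(\<omega> in M. D i k \<omega>) = 1 - P\<^sub>l"
    and initial_stamp_measurable:
      "\<And>i. i \<in> {1..n} \<Longrightarrow> s0 i \<in> measurable M (count_space UNIV)"
    and initial_stamp_range:
      "\<And>i \<omega>. i \<in> {1..n} \<Longrightarrow> \<omega> \<in> space M \<Longrightarrow> s0 i \<omega> \<in> frame_slots m (- 2)"

definition node_age ::
    "nat \<Rightarrow> (nat \<Rightarrow> int \<Rightarrow> 'w \<Rightarrow> bool) \<Rightarrow> (nat \<Rightarrow> nat \<Rightarrow> 'w \<Rightarrow> bool) \<Rightarrow> (nat \<Rightarrow> 'w \<Rightarrow> int)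
      \<Rightarrow> 'w \<Rightarrow> nat \<Rightarrow> real \<Rightarrow> real" where
  "node_age m A D s0 \<omega> i = age m (s0 i \<omega>) (\<lambda>s. A i s \<omega>) (\<lambda>k. D i k \<omega>)"

end

theory Submission
  imports Defs "HOL-Real_Asymp.Real_Asymp"
begin

text \<open>Let \<open>X k\<close> be the age of a node at the start of frame \<open>k\<close>, \<open>V k\<close> the indicator of a delivery
  in frame \<open>k\<close>, and \<open>W k = V k * B k\<close>, where \<open>B k\<close> is the distance from the generation of the
  delivered update to the start of the frame.  Then
  \<open>X (k + 1) = X k + m - V k * X k + W k\<close>, and \<open>(V k, W k)\<close> is independent of the past.  Summing
  over \<open>k\<close> and replacing \<open>V k\<close> and \<open>W k\<close> by their means \<open>\<xi>\<close> and \<open>\<beta>\<close>, which costs a martingale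
  with bounded second moments of increments, shows that \<open>T k = X 0 + \<dots> + X (k - 1)\<close> deviates from
  \<open>k * (m + \<beta>) / \<xi>\<close> by \<open>O(sqrt k)\<close> in mean square.  Along the subsequence of the squares the
  normalised variances are summable, which gives almost sure convergence, and monotonicity of the
  integral of the age extends the limit to all times.  The initial time-stamp need not be
  independent of the rest, so the argument is run for each of its finitely many possible values.\<close>

section \<open>Almost sure convergence and bounded random variables\<close>

text \<open>By monotone convergence the series of the \<open>f j\<close> has finite expectation. It
  is therefore almost surely finite, and the terms of a convergent series tend to 0.\<close>

lemma (in prob_space) AE_tendsto_0_if_summable_expectation:
  fixes f :: "nat \<Rightarrow> 'a \<Rightarrow> real"
  assumes int: "\<And>j. integrable M (f j)" and nonneg: "\<And>j \<omega>. 0 \<le> f j \<omega>"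
    and sum: "summable (\<lambda>j. expectation (f j))"
  shows "AE \<omega> in M. (\<lambda>j. f j \<omega>) \<longlonglongrightarrow> 0"
proof -
  have meas[measurable]: "f j \<in> borel_measurable M" for j
    using int by (rule borel_measurable_integrable)
  have "(\<integral>\<^sup>+\<omega>. (\<Sum>j. ennreal (f j \<omega>)) \<partial>M) = (\<Sum>j. \<integral>\<^sup>+\<omega>. ennreal (f j \<omega>) \<partial>M)"
    by (rule nn_integral_suminf) measurable
  also have "\<dots> = (\<Sum>j. ennreal (expectation (f j)))"
    by (intro suminf_cong nn_integral_eq_integral int) (auto simp: nonneg)
  also have "\<dots> < \<infinity>"
    using sum nonneg by (subst suminf_ennreal2) (auto intro: Bochner_Integration.integral_nonneg)
  finally have "AE \<omega> in M. (\<Sum>j. ennreal (f j \<omega>)) \<noteq> \<infinity>"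
    by (intro nn_integral_PInf_AE) (auto simp: less_top)
  then show ?thesis
  proof eventually_elim
    case (elim \<omega>)
    then have "summable (\<lambda>j. f j \<omega>)"
      by (intro summable_suminf_not_top) (auto simp: nonneg)
    then show ?case by (rule summable_LIMSEQ_zero)
  qed
qed

context prob_space
begin

text \<open>The bound is required at every point rather than almost everywhere, so closure under
  arithmetic involves no null sets. At a fixed frame index all variables of the chain are of this
  kind, which settles every integrability question.\<close>

definition bounded_rv :: "('a \<Rightarrow> real) \<Rightarrow> bool" where
  "bounded_rv f \<longleftrightarrow> f \<in> borel_measurable M \<and> (\<exists>B. \<forall>\<omega>. \<bar>f \<omega>\<bar> \<le> B)"

lemma bounded_rv_const: "bounded_rv (\<lambda>_. c)"
  by (auto simp: bounded_rv_def)

lemma bounded_rv_add: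
  assumes "bounded_rv f" "bounded_rv g"
  shows "bounded_rv (\<lambda>\<omega>. f \<omega> + g \<omega>)"
proof -
  obtain B C where "\<And>\<omega>. \<bar>f \<omega>\<bar> \<le> B" "\<And>\<omega>. \<bar>g \<omega>\<bar> \<le> C"
    using assms by (auto simp: bounded_rv_def)
  then have "\<bar>f \<omega> + g \<omega>\<bar> \<le> B + C" for \<omega>
    by (meson abs_triangle_ineq add_mono order_trans)
  then show ?thesis using assms by (auto simp: bounded_rv_def)
qed

lemma bounded_rv_mult:
  assumes "bounded_rv f" "bounded_rv g"
  shows "bounded_rv (\<lambda>\<omega>. f \<omega> * g \<omega>)"
proof -
  obtain B C where "\<And>\<omega>. \<bar>f \<omega>\<bar> \<le> B" "\<And>\<omega>. \<bar>g \<omega>\<bar> \<le> C"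
    using assms by (auto simp: bounded_rv_def)
  then have "\<bar>f \<omega> * g \<omega>\<bar> \<le> B * C" for \<omega>
    unfolding abs_mult by (meson abs_ge_zero mult_mono order_trans)
  then show ?thesis using assms by (auto simp: bounded_rv_def)
qed

lemma bounded_rv_diff:
  assumes "bounded_rv f" "bounded_rv g"
  shows "bounded_rv (\<lambda>\<omega>. f \<omega> - g \<omega>)"
  using bounded_rv_add[OF assms(1) bounded_rv_mult[OF bounded_rv_const[of "-1"] assms(2)]] by simp

lemma bounded_rv_power2: "bounded_rv f \<Longrightarrow> bounded_rv (\<lambda>\<omega>. (f \<omega>)\<^sup>2)"
  unfolding power2_eq_square by (rule bounded_rv_mult)

lemma bounded_rv_sum: "(\<And>i. i \<in> I \<Longrightarrow> bounded_rv (f i)) \<Longrightarrow> bounded_rv (\<lambda>\<omega>. \<Sum>i\<in>I. f i \<omega>)"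
  by (induction I rule: infinite_finite_induct) (auto intro: bounded_rv_const bounded_rv_add)

lemmas bounded_rv_intros = bounded_rv_const bounded_rv_add bounded_rv_mult bounded_rv_diff
  bounded_rv_power2 bounded_rv_sum

lemma bounded_rv_integrable: "bounded_rv f \<Longrightarrow> integrable M f"
  unfolding bounded_rv_def by (metis AE_I2 integrable_const_bound real_norm_def)

end

section \<open>Mean-square law of large numbers for a chain with random resets\<close>

text \<open>Abstracts the ages at the frame starts, with \<open>c\<close> the frame length.
  Independence is demanded of the pair of \<open>X k\<close> and the partial sum, because the
  martingale below is a function of both. \<open>W_le\<close> forces \<open>W\<close> to vanish when
  there is no reset.\<close>

locale reset_chain = prob_space M for M :: "'w measure" +
  fixes X V W :: "nat \<Rightarrow> 'w \<Rightarrow> real" and c x0 \<xi> \<beta> :: real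
  assumes X_0: "X 0 \<omega> = x0"
    and X_Suc: "X (Suc k) \<omega> = X k \<omega> + c - V k \<omega> * X k \<omega> + W k \<omega>"
    and V_cases: "V k \<omega> = 0 \<or> V k \<omega> = 1"
    and W_nonneg: "0 \<le> W k \<omega>" and W_le: "W k \<omega> \<le> c * V k \<omega>"
    and c_pos: "0 < c" and x0_nonneg: "0 \<le> x0" and x0_le: "x0 \<le> 2 * c"
    and indep: "indep_var (borel \<Otimes>\<^sub>M borel) (\<lambda>\<omega>. (X k \<omega>, \<Sum>j<k. X j \<omega>))
                          (borel \<Otimes>\<^sub>M borel) (\<lambda>\<omega>. (V k \<omega>, W k \<omega>))"
    and expectation_V: "expectation (V k) = \<xi>" and expectation_W: "expectation (W k) = \<beta>"
    and \<xi>_pos: "0 < \<xi>"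
begin

definition T :: "nat \<Rightarrow> 'w \<Rightarrow> real" where "T k \<omega> = (\<Sum>j<k. X j \<omega>)"

lemma V_range: "0 \<le> V k \<omega>" "V k \<omega> \<le> 1" and W_le_c: "W k \<omega> \<le> c"
  using V_cases[of k \<omega>] W_le[of k \<omega>] c_pos by auto

text \<open>A crude bound that grows with \<open>k\<close>. It serves only to make
  \<open>X k\<close> bounded for each fixed \<open>k\<close>; the uniform control is the
  second-moment bound below.\<close>

lemma X_range: "0 \<le> X k \<omega> \<and> X k \<omega> \<le> (real k + 2) * c"
proof (induction k)
  case 0
  show ?case using X_0[of \<omega>] x0_nonneg x0_le by simp
next
  case (Suc k)
  have "c + W k \<omega> \<le> 2 * c" using W_le_c[of k \<omega>] by simp
  also have "\<dots> \<le> (real (Suc k) + 2) * c" using c_pos by (intro mult_right_mono) auto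
  finally have "V k \<omega> = 1 \<Longrightarrow> ?case" using W_nonneg[of k \<omega>] c_pos by (simp add: X_Suc)
  moreover have "V k \<omega> = 0 \<Longrightarrow> ?case"
    using Suc W_le[of k \<omega>] W_nonneg[of k \<omega>] c_pos by (simp add: X_Suc algebra_simps)
  ultimately show ?case using V_cases[of k \<omega>] by blast
qed

lemma bounded_rv_V: "bounded_rv (V k)"
proof -
  have "V k \<in> borel_measurable M"
    using measurable_compose[OF indep_var_rv2[OF indep[of k]] measurable_fst] by simp
  then show ?thesis
    using V_range[of k] unfolding bounded_rv_def by (auto intro!: exI[of _ 1])
qed

lemma bounded_rv_W: "bounded_rv (W k)"
proof -
  have "W k \<in> borel_measurable M"
    using measurable_compose[OF indep_var_rv2[OF indep[of k]] measurable_snd] by simp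
  then show ?thesis
    using W_nonneg[of k] W_le_c[of k] unfolding bounded_rv_def by (auto intro!: exI[of _ c])
qed

lemma bounded_rv_X: "bounded_rv (X k)"
proof -
  have "X k \<in> borel_measurable M"
    using measurable_compose[OF indep_var_rv1[OF indep[of k]] measurable_fst] by simp
  then show ?thesis
    using X_range[of k] unfolding bounded_rv_def
    by (auto intro!: exI[of _ "(real k + 2) * c"])
qed

lemma bounded_rv_T: "bounded_rv (T k)"
  unfolding T_def by (intro bounded_rv_intros bounded_rv_X)

lemmas bounded_rvs = bounded_rv_intros bounded_rv_V bounded_rv_W bounded_rv_X bounded_rv_T

lemma expectation_indep:
  assumes [measurable]: "f \<in> borel_measurable (borel \<Otimes>\<^sub>M borel)"
      "g \<in> borel_measurable (borel \<Otimes>\<^sub>M borel)"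
    and f: "bounded_rv (\<lambda>\<omega>. f (X k \<omega>, T k \<omega>))" and g: "bounded_rv (\<lambda>\<omega>. g (V k \<omega>, W k \<omega>))"
  shows "expectation (\<lambda>\<omega>. f (X k \<omega>, T k \<omega>) * g (V k \<omega>, W k \<omega>)) =
    expectation (\<lambda>\<omega>. f (X k \<omega>, T k \<omega>)) * expectation (\<lambda>\<omega>. g (V k \<omega>, W k \<omega>))"
proof -
  have "indep_var borel (f \<circ> (\<lambda>\<omega>. (X k \<omega>, T k \<omega>))) borel (g \<circ> (\<lambda>\<omega>. (V k \<omega>, W k \<omega>)))"
    by (rule indep_var_compose[OF indep[of k, folded T_def]]) measurable
  then show ?thesis
    by (intro indep_var_lebesgue_integral bounded_rv_integrable f g) (simp add: comp_def)
qed

lemma \<xi>_le_1: "\<xi> \<le> 1"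
proof -
  have "expectation (V 0) \<le> expectation (\<lambda>_. 1)"
    by (intro integral_mono bounded_rv_integrable bounded_rvs V_range)
  then show ?thesis by (simp add: expectation_V prob_space)
qed

lemma \<beta>_range: "0 \<le> \<beta>" "\<beta> \<le> c"
proof -
  have "0 \<le> expectation (W 0)"
    by (intro Bochner_Integration.integral_nonneg W_nonneg)
  then show "0 \<le> \<beta>" by (simp add: expectation_W)
  have "expectation (W 0) \<le> expectation (\<lambda>_. c)"
    by (intro integral_mono bounded_rv_integrable bounded_rvs W_le_c)
  then show "\<beta> \<le> c" by (simp add: expectation_W prob_space)
qed

text \<open>After a reset the value is at most \<open>2 * c\<close>. Otherwise the cross term of
  \<open>(X k + c)^2\<close> is split by Young's inequality with weight \<open>\<xi> / 2\<close>.
  This weight is small enough that \<open>(1 + \<xi> / 2) * (1 - \<xi>)\<close> stays below 1, so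
  the bound contracts in expectation.\<close>

lemma X_Suc_power2_le:
  "(X (Suc k) \<omega>)\<^sup>2 \<le> (5 + 2 / \<xi>) * c\<^sup>2 + (1 + \<xi> / 2) * ((X k \<omega>)\<^sup>2 * (1 - V k \<omega>))"
  using V_cases[of k \<omega>]
proof
  assume V: "V k \<omega> = 0"
  have "0 \<le> (\<xi> * X k \<omega> - 2 * c)\<^sup>2 / (2 * \<xi>)" using \<xi>_pos by simp
  also have "\<dots> = \<xi> / 2 * (X k \<omega>)\<^sup>2 + 2 / \<xi> * c\<^sup>2 - 2 * X k \<omega> * c"
    using \<xi>_pos by (simp add: power2_eq_square field_simps)
  finally have "(X k \<omega> + c)\<^sup>2 \<le> (1 + \<xi> / 2) * (X k \<omega>)\<^sup>2 + (1 + 2 / \<xi>) * c\<^sup>2"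
    by (simp add: power2_sum algebra_simps)
  also have "\<dots> \<le> (1 + \<xi> / 2) * (X k \<omega>)\<^sup>2 + (5 + 2 / \<xi>) * c\<^sup>2"
    by (intro add_left_mono mult_right_mono) auto
  finally show ?thesis
    using V W_nonneg[of k \<omega>] W_le[of k \<omega>] by (simp add: X_Suc add.commute)
next
  assume V: "V k \<omega> = 1"
  have "(c + W k \<omega>)\<^sup>2 \<le> (2 * c)\<^sup>2"
    using W_nonneg[of k \<omega>] W_le_c[of k \<omega>] c_pos by (intro power_mono) auto
  also have "\<dots> \<le> (5 + 2 / \<xi>) * c\<^sup>2"
    using \<xi>_pos by (auto simp: power_mult_distrib intro!: mult_right_mono)
  finally show ?thesis using V by (simp add: X_Suc)
qed

text \<open>The fixed point of
  \<open>x \<mapsto> (5 + 2 / \<xi>) * c^2 + (1 - \<xi> / 2) * x\<close>. Since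
  \<open>(1 + \<xi> / 2) * (1 - \<xi>) \<le> 1 - \<xi> / 2\<close>, a second moment bounded by
  \<open>C\<close> remains so after one step.\<close>

definition C :: real where "C = 2 / \<xi> * (5 + 2 / \<xi>) * c\<^sup>2"

lemma expectation_X_power2_le: "expectation (\<lambda>\<omega>. (X k \<omega>)\<^sup>2) \<le> C"
proof (induction k)
  case 0
  have "4 \<le> 2 / \<xi> * (5 + 2 / \<xi>)"
    using mult_mono[of 2 "2 / \<xi>" 2 "5 + 2 / \<xi>"] \<xi>_pos \<xi>_le_1 by (simp add: field_simps)
  then have "(2 * c)\<^sup>2 \<le> C"
    unfolding C_def power_mult_distrib by (intro mult_right_mono) auto
  moreover have "x0\<^sup>2 \<le> (2 * c)\<^sup>2"
    using x0_nonneg x0_le by (intro power_mono) auto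
  ultimately show ?case by (simp add: X_0 prob_space)
next
  case (Suc k)
  have ind: "expectation (\<lambda>\<omega>. (X k \<omega>)\<^sup>2 * (1 - V k \<omega>)) =
      expectation (\<lambda>\<omega>. (X k \<omega>)\<^sup>2) * (1 - \<xi>)"
    using expectation_indep[of "\<lambda>(x, t). x\<^sup>2" "\<lambda>(v, w). 1 - v" k]
    by (simp add: bounded_rvs bounded_rv_integrable prob_space expectation_V)
  have "expectation (\<lambda>\<omega>. (X (Suc k) \<omega>)\<^sup>2) \<le>
      expectation (\<lambda>\<omega>. (5 + 2 / \<xi>) * c\<^sup>2 + (1 + \<xi> / 2) * ((X k \<omega>)\<^sup>2 * (1 - V k \<omega>)))"
    by (intro integral_mono bounded_rv_integrable bounded_rvs X_Suc_power2_le)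
  also have "\<dots> = (5 + 2 / \<xi>) * c\<^sup>2 + (1 + \<xi> / 2) * (expectation (\<lambda>\<omega>. (X k \<omega>)\<^sup>2) * (1 - \<xi>))"
    by (simp add: bounded_rvs bounded_rv_integrable prob_space ind)
  also have "\<dots> \<le> (5 + 2 / \<xi>) * c\<^sup>2 + (1 + \<xi> / 2) * (C * (1 - \<xi>))"
    using \<xi>_pos \<xi>_le_1 Suc by (intro add_left_mono mult_left_mono mult_right_mono) auto
  also have "(5 + 2 / \<xi>) * c\<^sup>2 = \<xi> / 2 * C"
    using \<xi>_pos by (simp add: C_def)
  also have "\<xi> / 2 * C + (1 + \<xi> / 2) * (C * (1 - \<xi>)) = C - C * \<xi>\<^sup>2 / 2"
    by (simp add: power2_eq_square field_simps)
  also have "\<dots> \<le> C" using \<xi>_pos by (simp add: C_def)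
  finally show ?case .
qed

text \<open>\<open>Q\<close> is a martingale: its increment \<open>(W k - \<beta>) - (V k - \<xi>) * X k\<close> is centred given the past.\<close>

definition Q :: "nat \<Rightarrow> 'w \<Rightarrow> real" where
  "Q k \<omega> = \<xi> * T k \<omega> + X k \<omega> - x0 - real k * (c + \<beta>)"

lemma bounded_rv_Q: "bounded_rv (Q k)"
  unfolding Q_def by (intro bounded_rvs)

text \<open>The two cross terms are kept exact, each as a function of the past times a centred
  function of the present, so that they vanish in expectation. Only the squared increment is
  estimated, using that \<open>V k - \<xi>\<close> is at most 1 and \<open>W k - \<beta>\<close> at
  most \<open>c\<close> in absolute value.\<close>

lemma Q_Suc_power2_le:
  "(Q (Suc k) \<omega>)\<^sup>2 \<le> (Q k \<omega>)\<^sup>2 + (2 * (X k \<omega>)\<^sup>2 + 2 * c\<^sup>2)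
     - 2 * ((Q k \<omega> * X k \<omega>) * (V k \<omega> - \<xi>)) + 2 * (Q k \<omega> * (W k \<omega> - \<beta>))"
proof -
  define a where "a = (V k \<omega> - \<xi>) * X k \<omega>"
  define b where "b = W k \<omega> - \<beta>"
  have Q_Suc: "Q (Suc k) \<omega> = Q k \<omega> - (a - b)"
    by (simp add: Q_def T_def X_Suc a_def b_def algebra_simps)
  have "(Q (Suc k) \<omega>)\<^sup>2 = (Q k \<omega>)\<^sup>2 + (a - b)\<^sup>2 - 2 * (Q k \<omega> * a) + 2 * (Q k \<omega> * b)"
    unfolding Q_Suc by (simp add: power2_eq_square algebra_simps)
  moreover have "(a - b)\<^sup>2 \<le> 2 * a\<^sup>2 + 2 * b\<^sup>2"
    using zero_le_power2[of "a + b"] by (simp add: power2_eq_square algebra_simps)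
  moreover have "(V k \<omega> - \<xi>)\<^sup>2 \<le> 1\<^sup>2"
    using V_range[of k \<omega>] \<xi>_pos \<xi>_le_1 by (intro power2_le_iff_abs_le[THEN iffD2]) auto
  then have "a\<^sup>2 \<le> (X k \<omega>)\<^sup>2"
    unfolding a_def power_mult_distrib by (intro mult_left_le_one_le) auto
  moreover have "b\<^sup>2 \<le> c\<^sup>2"
    using W_nonneg[of k \<omega>] W_le_c[of k \<omega>] \<beta>_range c_pos unfolding b_def
    by (intro power2_le_iff_abs_le[THEN iffD2]) auto
  ultimately show ?thesis by (simp add: a_def b_def algebra_simps)
qed

lemma expectation_Q_power2_le: "expectation (\<lambda>\<omega>. (Q k \<omega>)\<^sup>2) \<le> real k * (2 * C + 2 * c\<^sup>2)"
proof (induction k)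
  case 0
  show ?case by (simp add: Q_def T_def X_0)
next
  case (Suc k)
  note [simp] = bounded_rvs bounded_rv_Q bounded_rv_integrable prob_space
    expectation_V expectation_W
  \<comment> \<open>\<open>Q k\<close> as a measurable function of the pair
    \<open>(X k, T k)\<close>, the form in which \<open>expectation_indep\<close> applies.\<close>
  define q where "q = (\<lambda>(x, t). \<xi> * t + x - x0 - real k * (c + \<beta>))"
  have [measurable]: "q \<in> borel_measurable (borel \<Otimes>\<^sub>M borel)" unfolding q_def by measurable
  have q: "q (X k \<omega>, T k \<omega>) = Q k \<omega>" for \<omega> by (simp add: q_def Q_def)
  have "expectation (\<lambda>\<omega>. (Q k \<omega> * X k \<omega>) * (V k \<omega> - \<xi>)) = 0"
    using expectation_indep[of "\<lambda>p. q p * fst p" "\<lambda>(v, w). v - \<xi>" k] by (simp add: q)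
  moreover have "expectation (\<lambda>\<omega>. Q k \<omega> * (W k \<omega> - \<beta>)) = 0"
    using expectation_indep[of q "\<lambda>(v, w). w - \<beta>" k] by (simp add: q)
  moreover have "expectation (\<lambda>\<omega>. (Q (Suc k) \<omega>)\<^sup>2) \<le>
     expectation (\<lambda>\<omega>. (Q k \<omega>)\<^sup>2 + (2 * (X k \<omega>)\<^sup>2 + 2 * c\<^sup>2)
     - 2 * ((Q k \<omega> * X k \<omega>) * (V k \<omega> - \<xi>)) + 2 * (Q k \<omega> * (W k \<omega> - \<beta>)))"
    by (intro integral_mono bounded_rv_integrable bounded_rvs bounded_rv_Q Q_Suc_power2_le)
  ultimately have "expectation (\<lambda>\<omega>. (Q (Suc k) \<omega>)\<^sup>2) \<le>
      expectation (\<lambda>\<omega>. (Q k \<omega>)\<^sup>2) + (2 * expectation (\<lambda>\<omega>. (X k \<omega>)\<^sup>2) + 2 * c\<^sup>2)"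
    by simp
  then show ?case
    using Suc expectation_X_power2_le[of k] by (simp add: algebra_simps)
qed

text \<open>The candidate limit of \<open>T k / k\<close>: with
  \<open>\<xi> * \<mu> = c + \<beta>\<close>, the drift subtracted in \<open>Q\<close> equals
  \<open>\<xi>\<close> times \<open>k * \<mu>\<close>.\<close>

definition \<mu> :: real where "\<mu> = (c + \<beta>) / \<xi>"

lemma expectation_T_deviation:
  "\<exists>K. \<forall>k. expectation (\<lambda>\<omega>. (T k \<omega> - real k * \<mu>)\<^sup>2) \<le> K * (real k + 1)"
proof -
  define K where "K = (3 * (2 * C + 2 * c\<^sup>2) + 3 * C + 3 * x0\<^sup>2) / \<xi>\<^sup>2"
  have C: "0 \<le> C" using \<xi>_pos by (simp add: C_def)
  have "expectation (\<lambda>\<omega>. (T k \<omega> - real k * \<mu>)\<^sup>2) \<le> K * (real k + 1)" for k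
  proof -
    have "\<xi>\<^sup>2 * (T k \<omega> - real k * \<mu>)\<^sup>2 \<le> 3 * (Q k \<omega>)\<^sup>2 + 3 * (X k \<omega>)\<^sup>2 + 3 * x0\<^sup>2" for \<omega>
    proof -
      have "\<xi> * (T k \<omega> - real k * \<mu>) = Q k \<omega> - X k \<omega> + x0"
        using \<xi>_pos by (simp add: Q_def \<mu>_def right_diff_distrib)
      then have "\<xi>\<^sup>2 * (T k \<omega> - real k * \<mu>)\<^sup>2 = (Q k \<omega> - X k \<omega> + x0)\<^sup>2"
        by (metis power_mult_distrib)
      \<comment> \<open>The difference of the two sides is exactly the sum of the three squares
        supplied.\<close>
      also have "\<dots> \<le> 3 * (Q k \<omega>)\<^sup>2 + 3 * (X k \<omega>)\<^sup>2 + 3 * x0\<^sup>2"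
        using zero_le_power2[of "Q k \<omega> + X k \<omega>"] zero_le_power2[of "X k \<omega> + x0"]
          zero_le_power2[of "Q k \<omega> - x0"]
        by (simp add: power2_eq_square algebra_simps)
      finally show ?thesis .
    qed
    then have "expectation (\<lambda>\<omega>. \<xi>\<^sup>2 * (T k \<omega> - real k * \<mu>)\<^sup>2) \<le>
        expectation (\<lambda>\<omega>. 3 * (Q k \<omega>)\<^sup>2 + 3 * (X k \<omega>)\<^sup>2 + 3 * x0\<^sup>2)"
      by (intro integral_mono bounded_rv_integrable bounded_rvs bounded_rv_Q)
    also have "\<dots> = 3 * expectation (\<lambda>\<omega>. (Q k \<omega>)\<^sup>2) + 3 * expectation (\<lambda>\<omega>. (X k \<omega>)\<^sup>2) + 3 * x0\<^sup>2"
      by (simp add: bounded_rvs bounded_rv_Q bounded_rv_integrable prob_space)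
    also have "\<dots> \<le> 3 * (real k * (2 * C + 2 * c\<^sup>2)) + 3 * C + 3 * x0\<^sup>2"
      using expectation_Q_power2_le[of k] expectation_X_power2_le[of k] by simp
    also have "\<dots> \<le> (3 * (2 * C + 2 * c\<^sup>2) + 3 * C + 3 * x0\<^sup>2) * (real k + 1)"
      using C by (simp add: algebra_simps)
    also have "\<dots> = \<xi>\<^sup>2 * (K * (real k + 1))"
      using \<xi>_pos by (simp add: K_def)
    finally show ?thesis using \<xi>_pos by simp
  qed
  then show ?thesis by blast
qed

text \<open>The variance of \<open>T k / k\<close> about \<open>\<mu>\<close> is
  \<open>O(1 / k)\<close>, which is not summable over all \<open>k\<close> but is summable over
  \<open>k = (j + 1)^2\<close>. Starting at \<open>Suc j\<close> avoids division by 0.\<close>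

lemma AE_T_squares_tendsto:
  "AE \<omega> in M. (\<lambda>j. T (Suc j ^ 2) \<omega> / real (Suc j ^ 2)) \<longlonglongrightarrow> \<mu>"
proof -
  define f where "f j \<omega> = (T (Suc j ^ 2) \<omega> / real (Suc j ^ 2) - \<mu>)\<^sup>2" for j \<omega>
  obtain K where K: "\<And>k. expectation (\<lambda>\<omega>. (T k \<omega> - real k * \<mu>)\<^sup>2) \<le> K * (real k + 1)"
    using expectation_T_deviation by blast
  have int: "integrable M (f j)" for j
    unfolding f_def divide_inverse by (intro bounded_rv_integrable bounded_rvs)
  have "0 \<le> expectation (\<lambda>\<omega>. (T 0 \<omega> - real 0 * \<mu>)\<^sup>2)" by simp
  also have "\<dots> \<le> K" using K[of 0] by simp
  finally have "0 \<le> K" .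
  have le: "expectation (f j) \<le> 2 * K * (1 / real (Suc j) ^ 2)" for j
  proof -
    define k where "k = Suc j ^ 2"
    have k: "1 \<le> real k" by (simp add: k_def)
    then have "f j = (\<lambda>\<omega>. (T k \<omega> - real k * \<mu>)\<^sup>2 / (real k)\<^sup>2)"
      by (auto simp: f_def k_def[symmetric] fun_eq_iff power_divide[symmetric] diff_divide_distrib)
    then have "expectation (f j) \<le> K * (real k + 1) / (real k)\<^sup>2"
      using K[of k] by (simp add: divide_right_mono)
    also have "\<dots> \<le> K * (2 * real k) / (real k)\<^sup>2"
      using k \<open>0 \<le> K\<close> by (intro divide_right_mono mult_left_mono) auto
    also have "\<dots> = 2 * K * (1 / real k)"
      using k by (simp add: power2_eq_square)
    finally show ?thesis by (simp add: k_def)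
  qed
  have "summable (\<lambda>j. 2 * K * (1 / real (Suc j) ^ 2))"
    using inverse_power_summable[of 2, where ?'a = real]
    by (intro summable_mult) (subst summable_Suc_iff, simp add: inverse_eq_divide)
  then have "summable (\<lambda>j. expectation (f j))"
    by (rule summable_comparison_test') (use le in \<open>auto simp: f_def\<close>)
  then have "AE \<omega> in M. (\<lambda>j. f j \<omega>) \<longlonglongrightarrow> 0"
    by (intro AE_tendsto_0_if_summable_expectation int) (simp add: f_def)
  then show ?thesis
    by eventually_elim (simp add: f_def LIM_zero_iff)
qed

end

section \<open>From square times to all times\<close>

text \<open>If \<open>c * i^2 \<le> t \<le> c * (i + 1)^2\<close>, monotonicity traps
  \<open>F t / t\<close> between the averages at these two times, up to the factors
  \<open>(i / (i + 1))^2\<close> and \<open>((i + 1) / i)^2\<close>. Both factors tend to 1.\<close>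

lemma tendsto_average_if_squares:
  fixes F :: "real \<Rightarrow> real"
  assumes c: "0 < c" and nonneg: "\<And>t. 0 \<le> t \<Longrightarrow> 0 \<le> F t"
    and mono: "\<And>s t. 0 \<le> s \<Longrightarrow> s \<le> t \<Longrightarrow> F s \<le> F t"
    and lim: "(\<lambda>j. F (c * real (Suc j ^ 2)) / (c * real (Suc j ^ 2))) \<longlonglongrightarrow> L"
  shows "((\<lambda>t. F t / t) \<longlongrightarrow> L) at_top"
proof -
  define j where "j t = nat \<lfloor>sqrt (t / c)\<rfloor>" for t
  define G where "G i = F (c * (real i)\<^sup>2) / (c * (real i)\<^sup>2)" for i
  have "(\<lambda>i. G (Suc i)) \<longlonglongrightarrow> L" using lim by (simp add: G_def)
  then have G: "G \<longlonglongrightarrow> L" by (simp add: filterlim_sequentially_Suc)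
  have r: "(\<lambda>i. ((real i + 1) / real i)\<^sup>2) \<longlonglongrightarrow> 1" "(\<lambda>i. (real i / (real i + 1))\<^sup>2) \<longlonglongrightarrow> 1"
    by real_asymp+
  have "filterlim (\<lambda>t. nat \<lfloor>sqrt (t / c)\<rfloor>) at_top at_top"
    using c by real_asymp
  then have j: "filterlim j at_top at_top" unfolding j_def .
  have lower: "((\<lambda>t. G (j t) * (real (j t) / (real (j t) + 1))\<^sup>2) \<longlongrightarrow> L) at_top"
    using filterlim_compose[OF tendsto_mult[OF G r(2)] j] by simp
  have upper: "((\<lambda>t. G (Suc (j t)) * ((real (j t) + 1) / real (j t))\<^sup>2) \<longlongrightarrow> L) at_top"
    using filterlim_compose[OF tendsto_mult[OF LIMSEQ_Suc[OF G] r(1)] j] by simp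
  \<comment> \<open>Restricting to \<open>c \<le> t\<close> gives \<open>1 \<le> j t\<close>, so no
    denominator is 0.\<close>
  have bounds: "G (j t) * (real (j t) / (real (j t) + 1))\<^sup>2 \<le> F t / t \<and>
      F t / t \<le> G (Suc (j t)) * ((real (j t) + 1) / real (j t))\<^sup>2" if "c \<le> t" for t
  proof -
    have t: "0 < t" "1 \<le> sqrt (t / c)" using that c by auto
    define i where "i = real (j t)"
    have "i = of_int \<lfloor>sqrt (t / c)\<rfloor>" using t(2) by (simp add: i_def j_def)
    moreover have "1 \<le> \<lfloor>sqrt (t / c)\<rfloor>" using t(2) by simp
    ultimately have i: "1 \<le> i" "i \<le> sqrt (t / c)" "sqrt (t / c) \<le> i + 1"
      by linarith+
    have "i\<^sup>2 \<le> (sqrt (t / c))\<^sup>2" using i by (intro power_mono) auto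
    moreover have "(sqrt (t / c))\<^sup>2 \<le> (i + 1)\<^sup>2" using i t(1) c by (intro power_mono) auto
    ultimately have *: "c * i\<^sup>2 \<le> t" "t \<le> c * (i + 1)\<^sup>2"
      using t(1) c by (auto simp: field_simps)
    have "G (j t) * (real (j t) / (real (j t) + 1))\<^sup>2 = F (c * i\<^sup>2) / (c * (i + 1)\<^sup>2)"
      using i(1) by (simp add: G_def i_def power_divide)
    also have "\<dots> \<le> F t / t"
      using * t(1) c nonneg[of t] mono[of "c * i\<^sup>2" t] by (intro frac_le) auto
    finally have 1: "G (j t) * (real (j t) / (real (j t) + 1))\<^sup>2 \<le> F t / t" .
    have "F t / t \<le> F (c * (i + 1)\<^sup>2) / (c * i\<^sup>2)"
      using * t(1) c i nonneg[of "c * (i + 1)\<^sup>2"] mono[of t "c * (i + 1)\<^sup>2"] by (intro frac_le) auto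
    also have "\<dots> = G (Suc (j t)) * ((real (j t) + 1) / real (j t))\<^sup>2"
      using i(1) by (simp add: G_def i_def power_divide add.commute)
    finally show ?thesis using 1 by simp
  qed
  show ?thesis
    by (rule tendsto_sandwich[OF _ _ lower upper])
      (use bounds in \<open>auto intro!: eventually_mono[OF eventually_ge_at_top[of c]]\<close>)
qed

section \<open>Recursion for the age at the starts of frames\<close>

text \<open>The packet of frame \<open>j\<close> counts from time \<open>(j + 1) * m\<close> on. At
  the very start of frame \<open>k\<close> the packet of frame \<open>k - 1\<close> is thus already
  included, while that of frame \<open>k\<close> itself never is.\<close>

lemma received_by_frame:
  assumes "m \<ge> 1" "real k * real m \<le> t" "t < (real k + 1) * real m"
  shows "received_by m a d t = {j. j < k \<and> delivered m a d j}"
proof -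
  have "real ((j + 1) * m) \<le> t \<longleftrightarrow> j < k" for j
  proof
    assume "real ((j + 1) * m) \<le> t"
    with assms(3) have "real (j + 1) * real m < real (k + 1) * real m" by (simp add: distrib_right)
    then show "j < k" using assms(1) by (simp del: of_nat_add)
  next
    assume "j < k"
    then have "real ((j + 1) * m) \<le> real (k * m)" using mult_le_mono1[of "j + 1" k m] by linarith
    then show "real ((j + 1) * m) \<le> t" using assms(2) by simp
  qed
  then show ?thesis by (auto simp: received_by_def)
qed

definition frame_age :: "nat \<Rightarrow> int \<Rightarrow> (int \<Rightarrow> bool) \<Rightarrow> (nat \<Rightarrow> bool) \<Rightarrow> nat \<Rightarrow> real" where
  "frame_age m s0 a d k = age m s0 a d (real k * real m)"

lemma age_eq_frame_age:
  assumes "m \<ge> 1" "real k * real m \<le> t" "t < (real k + 1) * real m"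
  shows "age m s0 a d t = frame_age m s0 a d k + (t - real k * real m)"
proof -
  have "received_by m a d t = received_by m a d (real k * real m)"
    using received_by_frame[OF assms] received_by_frame[of m k "real k * real m"] assms(1) by simp
  then show ?thesis by (simp add: age_def frame_age_def last_stamp_def)
qed

lemma frame_age_0: "m \<ge> 1 \<Longrightarrow> frame_age m s0 a d 0 = - real_of_int s0"
  by (simp add: frame_age_def age_def last_stamp_def received_by_frame[where k = 0])

text \<open>The variable \<open>W k\<close> of the chain. It measures the age of the update at the
  start of frame \<open>k\<close>; the further \<open>m\<close> slots until decoding come from the
  drift in \<open>frame_age_Suc\<close>. The value 0 without delivery puts both cases into one
  formula.\<close>

definition reset_age :: "nat \<Rightarrow> (int \<Rightarrow> bool) \<Rightarrow> (nat \<Rightarrow> bool) \<Rightarrow> nat \<Rightarrow> real" where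
  "reset_age m a d k =
     (if delivered m a d k then real k * real m - real_of_int (sent_stamp m a k) else 0)"

lemma frame_age_Suc:
  assumes m: "m \<ge> 1"
  shows "frame_age m s0 a d (Suc k) = frame_age m s0 a d k + real m
     - of_bool (delivered m a d k) * frame_age m s0 a d k + reset_age m a d k"
proof -
  have rec: "received_by m a d (real k * real m) = {j. j < k \<and> delivered m a d j}" for k
    using m by (intro received_by_frame) (auto simp: algebra_simps)
  show ?thesis
  proof (cases "delivered m a d k")
    case True
    have "Max {j. j < Suc k \<and> delivered m a d j} = k"
      using True by (intro Max_eqI) auto
    moreover have "\<exists>j. j < Suc k \<and> delivered m a d j" using True by blast
    ultimately have "last_stamp m s0 a d (real (Suc k) * real m) = sent_stamp m a k"
      unfolding last_stamp_def rec by auto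
    then show ?thesis
      using True unfolding frame_age_def age_def reset_age_def by (simp add: algebra_simps)
  next
    case False
    then have "{j. j < Suc k \<and> delivered m a d j} = {j. j < k \<and> delivered m a d j}"
      by (auto simp: less_Suc_eq)
    then have "last_stamp m s0 a d (real (Suc k) * real m) = last_stamp m s0 a d (real k * real m)"
      unfolding last_stamp_def rec by (simp only:)
    then show ?thesis
      using False unfolding frame_age_def age_def reset_age_def by (simp add: algebra_simps)
  qed
qed

text \<open>Delivery and reset age are expressed through these events, whose probabilities
  \<open>(1 - \<rho>) ^ b\<close> follow from independence of the slots, without handling
  \<open>Max\<close>. For \<open>b = 0\<close> the condition is vacuous, for \<open>b = m\<close> it
  says that the whole preceding frame is silent.\<close>

definition idle :: "nat \<Rightarrow> (int \<Rightarrow> bool) \<Rightarrow> nat \<Rightarrow> nat \<Rightarrow> bool" where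
  "idle m a k b \<longleftrightarrow> (\<forall>s \<in> {int k * int m - int b..<int k * int m}. \<not> a s)"

lemma frame_slots_pred: "frame_slots m (int k - 1) = {int k * int m - int m..<int k * int m}"
  by (simp add: frame_slots_def algebra_simps)

lemma delivered_iff_idle: "delivered m a d k \<longleftrightarrow> d k \<and> \<not> idle m a k m"
  by (auto simp: delivered_def transmits_def idle_def frame_slots_pred)

text \<open>Before an active slot at distance \<open>B\<close> from the end of the frame, the last \<open>b\<close> slots
  are idle exactly for \<open>b < B\<close>; the subtracted term cancels the count in an idle frame.\<close>

lemma reset_age_eq_idle:
  "reset_age m a d k = of_bool (d k) *
     ((\<Sum>b<m. of_bool (idle m a k b)) - real m * of_bool (idle m a k m))"
proof (cases "idle m a k m")
  case True
  then have "idle m a k b" if "b < m" for b using that by (auto simp: idle_def)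
  then show ?thesis using True by (simp add: reset_age_def delivered_iff_idle)
next
  case False
  define S where "S = {s \<in> frame_slots m (int k - 1). a s}"
  define \<sigma> where "\<sigma> = Max S"
  have "finite (frame_slots m (int k - 1))" by (simp add: frame_slots_def)
  then have fin: "finite S" by (rule finite_subset[rotated]) (auto simp: S_def)
  have "S \<noteq> {}" using False by (auto simp: S_def idle_def frame_slots_pred)
  with fin have "\<sigma> \<in> S" unfolding \<sigma>_def by (rule Max_in)
  then have \<sigma>: "a \<sigma>" "int k * int m - int m \<le> \<sigma>" "\<sigma> < int k * int m"
    by (auto simp: S_def frame_slots_pred)
  have max: "s \<le> \<sigma>" if "s \<in> S" for s
    using fin that by (simp add: \<sigma>_def)
  have "idle m a k b \<longleftrightarrow> b < nat (int k * int m - \<sigma>)" if "b < m" for b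
  proof
    assume "idle m a k b"
    with \<sigma> have "\<sigma> < int k * int m - int b" unfolding idle_def by force
    then show "b < nat (int k * int m - \<sigma>)" by linarith
  next
    assume b: "b < nat (int k * int m - \<sigma>)"
    show "idle m a k b"
      unfolding idle_def
    proof (intro ballI notI)
      fix s assume s: "s \<in> {int k * int m - int b..<int k * int m}" "a s"
      then have "s \<in> S" using that by (auto simp: S_def frame_slots_pred)
      then show False using max[of s] s b by auto
    qed
  qed
  then have "(\<Sum>b<m. of_bool (idle m a k b)) = (\<Sum>b<m. of_bool (b < nat (int k * int m - \<sigma>)))"
    by (intro sum.cong) auto
  also have "\<dots> = real (card ({..<m} \<inter> {b. b < nat (int k * int m - \<sigma>)}))"
    by (subst sum_of_bool_eq) auto
  also have "{..<m} \<inter> {b. b < nat (int k * int m - \<sigma>)} = {..<nat (int k * int m - \<sigma>)}"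
    using \<sigma> by auto
  finally have "(\<Sum>b<m. of_bool (idle m a k b)) = real k * real m - real_of_int \<sigma>"
    using \<sigma> by simp
  then show ?thesis
    using False by (simp add: reset_age_def delivered_iff_idle sent_stamp_def \<sigma>_def S_def)
qed

lemma reset_age_range:
  "0 \<le> reset_age m a d k" "reset_age m a d k \<le> real m * of_bool (delivered m a d k)"
proof -
  have "(\<Sum>b<m. of_bool (idle m a k b)) \<le> (\<Sum>b<m. 1 :: real)"
    by (intro sum_mono) auto
  moreover have "(\<Sum>b<m. of_bool (idle m a k b)) = (\<Sum>b<m. 1 :: real)" if "idle m a k m"
    using that by (intro sum.cong) (auto simp: idle_def)
  moreover have "0 \<le> (\<Sum>b<m. of_bool (idle m a k b) :: real)" by (intro sum_nonneg) auto
  ultimately show "0 \<le> reset_age m a d k" "reset_age m a d k \<le> real m * of_bool (delivered m a d k)"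
    unfolding reset_age_eq_idle delivered_iff_idle
    by (cases "d k"; cases "idle m a k m"; simp)+
qed

lemma frame_age_nonneg:
  assumes "m \<ge> 1" "s0 \<le> 0"
  shows "0 \<le> frame_age m s0 a d k"
proof (induction k)
  case 0
  show ?case using assms by (simp add: frame_age_0)
next
  case (Suc k)
  then show ?case
    using reset_age_range(1)[of m a d k]
    by (cases "delivered m a d k") (simp_all add: frame_age_Suc[OF assms(1)])
qed

text \<open>Packets sent before frame \<open>k\<close> carry updates from before frame
  \<open>k - 1\<close>. This is what separates the age at frame \<open>k\<close> from the activity
  in frame \<open>k - 1\<close>, which determines the packet of frame \<open>k\<close>.\<close>

lemma frame_age_cong:
  assumes m: "m \<ge> 1"
    and a: "\<And>s. - int m \<le> s \<Longrightarrow> s < (int k - 1) * int m \<Longrightarrow> a s = a' s"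
    and d: "\<And>j. j < k \<Longrightarrow> d j = d' j"
  shows "frame_age m s0 a d k = frame_age m s0 a' d' k"
  using a d
proof (induction k)
  case 0
  show ?case using m by (simp add: frame_age_0)
next
  case (Suc k)
  have le: "(int k - 1) * int m \<le> (int (Suc k) - 1) * int m" by (intro mult_right_mono) auto
  have idle: "idle m a k b = idle m a' k b" if "b \<le> m" for b
  proof -
    have "- int m \<le> s" if "int k * int m - int b \<le> s" for s
    proof -
      have "0 \<le> int k * int m" by simp
      then show ?thesis using that \<open>b \<le> m\<close> by linarith
    qed
    then show ?thesis using Suc.prems(1) by (auto simp: idle_def)
  qed
  have "(\<Sum>b<m. of_bool (idle m a k b)) = (\<Sum>b<m. of_bool (idle m a' k b) :: real)"
    by (intro sum.cong) (auto simp: idle)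
  moreover have "d k = d' k" using Suc.prems(2) by simp
  moreover have "frame_age m s0 a d k = frame_age m s0 a' d' k"
    using Suc.prems le by (intro Suc.IH) auto
  ultimately show ?case
    by (simp add: frame_age_Suc[OF m] reset_age_eq_idle delivered_iff_idle idle)
qed

section \<open>Integral and time average of the age along one path\<close>

text \<open>The age is affine on the frame except at the right endpoint, where the reset may already
  have occurred; a single point does not affect the integral.\<close>

lemma age_has_integral_frame:
  assumes m: "m \<ge> 1"
  shows "(age m s0 a d has_integral (real m * frame_age m s0 a d k + (real m)\<^sup>2 / 2))
    {real k * real m..(real k + 1) * real m}"
proof (rule has_integral_spike_finite[where S = "{(real k + 1) * real m}"])
  define x where "x = frame_age m s0 a d k"
  have "((\<lambda>t. x + (t - real k * real m)) has_integral
      (x * ((real k + 1) * real m) + ((real k + 1) * real m - real k * real m)\<^sup>2 / 2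
      - (x * (real k * real m) + (real k * real m - real k * real m)\<^sup>2 / 2)))
      {real k * real m..(real k + 1) * real m}"
    by (rule fundamental_theorem_of_calculus)
      (auto intro!: derivative_eq_intros mult_right_mono
        simp flip: has_real_derivative_iff_has_vector_derivative)
  then show "((\<lambda>t. frame_age m s0 a d k + (t - real k * real m)) has_integral
      (real m * frame_age m s0 a d k + (real m)\<^sup>2 / 2)) {real k * real m..(real k + 1) * real m}"
    by (simp add: x_def algebra_simps)
qed (use m in \<open>auto intro: age_eq_frame_age\<close>)

lemma age_has_integral:
  assumes m: "m \<ge> 1"
  shows "(age m s0 a d has_integral
      (real m * (\<Sum>j<k. frame_age m s0 a d j) + real k * (real m)\<^sup>2 / 2)) {0..real k * real m}"
proof (induction k)
  case 0
  show ?case by (simp add: has_integral_refl)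
next
  case (Suc k)
  have "(age m s0 a d has_integral
      (real m * (\<Sum>j<k. frame_age m s0 a d j) + real k * (real m)\<^sup>2 / 2) +
      (real m * frame_age m s0 a d k + (real m)\<^sup>2 / 2)) {0..(real k + 1) * real m}"
    by (rule has_integral_combine[OF _ _ Suc age_has_integral_frame[OF m]])
      (auto intro: mult_right_mono)
  then show ?case by (simp add: algebra_simps add_divide_distrib)
qed

lemma age_integrable_on:
  assumes m: "m \<ge> 1"
  shows "age m s0 a d integrable_on {0..t}"
proof -
  obtain k where "t / real m \<le> real k" using real_arch_simple by blast
  then have "t \<le> real k * real m" using m by (simp add: pos_divide_le_eq)
  then show ?thesis
    by (intro integrable_on_subinterval[OF has_integral_integrable[OF age_has_integral[OF m, where k = k]]]) simp
qed

lemma age_nonneg: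
  assumes m: "m \<ge> 1" and "s0 \<le> 0" "0 \<le> t"
  shows "0 \<le> age m s0 a d t"
proof -
  define k where "k = nat \<lfloor>t / real m\<rfloor>"
  have "0 \<le> t / real m" using assms by simp
  then have "real k = of_int \<lfloor>t / real m\<rfloor>" by (simp add: k_def)
  then have "real k \<le> t / real m" "t / real m < real k + 1"
    by linarith+
  then have k: "real k * real m \<le> t" "t < (real k + 1) * real m"
    using m by (simp_all add: pos_le_divide_eq pos_divide_less_eq)
  show ?thesis
    using frame_age_nonneg[OF m \<open>s0 \<le> 0\<close>, of a d k] age_eq_frame_age[OF m k, of s0 a d] k(1)
    by simp
qed

text \<open>At time \<open>k * m\<close> the average is exactly \<open>m / 2\<close>, from the
  linear growth inside frames, plus the mean of the first \<open>k\<close> frame ages. Nonnegativity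
  of the age makes its integral monotone, so square values of \<open>k\<close> suffice.\<close>

lemma time_average_age_tendsto:
  assumes m: "m \<ge> 1" and s0: "s0 \<le> 0"
    and lim: "(\<lambda>j. (\<Sum>i<Suc j ^ 2. frame_age m s0 a d i) / real (Suc j ^ 2)) \<longlonglongrightarrow> \<mu>"
  shows "(time_average (age m s0 a d) \<longlongrightarrow> real m / 2 + \<mu>) at_top"
proof -
  define F where "F t = integral {0..t} (age m s0 a d)" for t
  have "((\<lambda>t. F t / t) \<longlongrightarrow> real m / 2 + \<mu>) at_top"
  proof (rule tendsto_average_if_squares[of "real m"])
    show "0 \<le> F t" for t
      unfolding F_def by (intro integral_nonneg age_integrable_on m) (auto intro: age_nonneg m s0)
    show "F s \<le> F t" if "0 \<le> s" "s \<le> t" for s t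
      unfolding F_def using that
      by (intro integral_subset_le age_integrable_on m) (auto intro: age_nonneg m s0)
    have "F (real m * real (Suc j ^ 2)) / (real m * real (Suc j ^ 2)) =
        real m / 2 + (\<Sum>i<Suc j ^ 2. frame_age m s0 a d i) / real (Suc j ^ 2)" for j
    proof -
      define k where "k = Suc j ^ 2"
      have "real k > 0" "real m > 0" using m by (auto simp: k_def)
      then show ?thesis
        unfolding k_def[symmetric] F_def mult.commute[of "real m"]
        by (subst integral_unique[OF age_has_integral[OF m]]) (simp add: field_simps power2_eq_square)
    qed
    then show "(\<lambda>j. F (real m * real (Suc j ^ 2)) / (real m * real (Suc j ^ 2)))
        \<longlonglongrightarrow> real m / 2 + \<mu>"
      by (simp only:) (intro tendsto_add tendsto_const lim)
  qed (use m in auto)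
  then show ?thesis unfolding time_average_def F_def by simp
qed

section \<open>Probability model of a single node\<close>

context prob_space
begin

lemma expectation_of_bool:
  assumes "P \<in> measurable M (count_space UNIV)"
  shows "expectation (\<lambda>\<omega>. of_bool (P \<omega>)) = \<P>(\<omega> in M. P \<omega>)"
proof -
  have "{\<omega> \<in> space M. P \<omega>} \<in> events" using assms by simp
  then have "prob {\<omega> \<in> space M. P \<omega>} = expectation (indicator {\<omega> \<in> space M. P \<omega>})" by simp
  also have "\<dots> = expectation (\<lambda>\<omega>. of_bool (P \<omega>))"
    by (intro Bochner_Integration.integral_cong) (auto simp: indicator_def)
  finally show ?thesis by simp
qed

end

text \<open>The initial time-stamp is not part of this model. It enters as a constant parameter
  \<open>s0\<close> of \<open>X\<close>, so that ages are functions of activity and decoding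
  alone.\<close>

locale irsa_node = prob_space M for M :: "'w measure" +
  fixes m :: nat and \<rho> P\<^sub>l :: real and a :: "int \<Rightarrow> 'w \<Rightarrow> bool" and d :: "nat \<Rightarrow> 'w \<Rightarrow> bool"
  assumes m: "m \<ge> 1" and \<rho>: "0 < \<rho>" "\<rho> < 1" and P\<^sub>l: "0 \<le> P\<^sub>l" "P\<^sub>l < 1"
    and indep: "indep_vars (\<lambda>_. count_space UNIV) (case_sum a d) ({- int m..} <+> UNIV)"
    and prob_a: "\<And>s. s \<ge> - int m \<Longrightarrow> \<P>(\<omega> in M. a s \<omega>) = \<rho>"
    and prob_d: "\<And>k. \<P>(\<omega> in M. d k \<omega>) = 1 - P\<^sub>l"
begin

abbreviation X :: "int \<Rightarrow> nat \<Rightarrow> 'w \<Rightarrow> real" where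
  "X s0 k \<omega> \<equiv> frame_age m s0 (\<lambda>s. a s \<omega>) (\<lambda>j. d j \<omega>) k"
abbreviation V :: "nat \<Rightarrow> 'w \<Rightarrow> real" where
  "V k \<omega> \<equiv> of_bool (delivered m (\<lambda>s. a s \<omega>) (\<lambda>j. d j \<omega>) k)"
abbreviation W :: "nat \<Rightarrow> 'w \<Rightarrow> real" where
  "W k \<omega> \<equiv> reset_age m (\<lambda>s. a s \<omega>) (\<lambda>j. d j \<omega>) k"

lemma measurable_a: "s \<ge> - int m \<Longrightarrow> a s \<in> measurable M (count_space UNIV)"
  using indep unfolding indep_vars_def by force

lemma measurable_d: "d k \<in> measurable M (count_space UNIV)"
  using indep unfolding indep_vars_def by force

text \<open>The indices that determine the ages up to frame \<open>k\<close>; \<open>Inl\<close>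
  marks slots and \<open>Inr\<close> decodings. They are disjoint from \<open>present k\<close>,
  which holds the slots of frame \<open>k - 1\<close> and the decoding in frame \<open>k\<close>.
  For \<open>k = 0\<close> the past is empty.\<close>

definition past :: "nat \<Rightarrow> (int + nat) set" where
  "past k = {- int m..<(int k - 1) * int m} <+> {..<k}"
definition present :: "nat \<Rightarrow> (int + nat) set" where
  "present k = {(int k - 1) * int m..<int k * int m} <+> {k}"

text \<open>Both functions factor through finitely many Boolean coordinates, taken from disjoint
  index sets. On such a finite product every map is measurable, so only locality of \<open>f\<close>
  and \<open>g\<close> has to be checked.\<close>

lemma indep_past_present:
  fixes f :: "(int \<Rightarrow> bool) \<Rightarrow> (nat \<Rightarrow> bool) \<Rightarrow> 'b" and g :: "(int \<Rightarrow> bool) \<Rightarrow> (nat \<Rightarrow> bool) \<Rightarrow> 'b"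
  assumes f: "\<And>x y x' y'. (\<And>s. - int m \<le> s \<Longrightarrow> s < (int k - 1) * int m \<Longrightarrow> x s = x' s) \<Longrightarrow>
      (\<And>j. j < k \<Longrightarrow> y j = y' j) \<Longrightarrow> f x y = f x' y'"
    and g: "\<And>x y x' y'. (\<And>s. (int k - 1) * int m \<le> s \<Longrightarrow> s < int k * int m \<Longrightarrow> x s = x' s) \<Longrightarrow>
      y k = y' k \<Longrightarrow> g x y = g x' y'"
    and space: "space N = UNIV" "space N' = UNIV"
  shows "indep_var N (\<lambda>\<omega>. f (\<lambda>s. a s \<omega>) (\<lambda>j. d j \<omega>)) N' (\<lambda>\<omega>. g (\<lambda>s. a s \<omega>) (\<lambda>j. d j \<omega>))"
proof -
  let ?P = "\<lambda>I. PiM I (\<lambda>_. count_space UNIV :: bool measure)"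
  let ?R = "\<lambda>I \<omega>. restrict (\<lambda>i. case_sum a d i \<omega>) I"
  have le: "- int m \<le> (int k - 1) * int m"
    using mult_right_mono[of "-1" "int k - 1" "int m"] by simp
  have ind: "indep_var (?P (past k)) (?R (past k)) (?P (present k)) (?R (present k))"
    by (rule indep_var_restrict[OF indep]) (use le in \<open>auto simp: past_def present_def\<close>)
  have P: "?P I = count_space (PiE I (\<lambda>_. UNIV))" if "finite I" for I :: "(int + nat) set"
    using that by (intro count_space_PiM_finite) auto
  have fin: "finite (past k)" "finite (present k)"
    by (auto simp: past_def present_def)
  let ?f = "\<lambda>r. f (\<lambda>s. r (Inl s)) (\<lambda>j. r (Inr j))" and ?g = "\<lambda>r. g (\<lambda>s. r (Inl s)) (\<lambda>j. r (Inr j))"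
  have "indep_var N (?f \<circ> ?R (past k)) N' (?g \<circ> ?R (present k))"
    by (rule indep_var_compose[OF ind]) (auto simp: P fin space)
  \<comment> \<open>Restriction makes the coordinates outside \<open>past k\<close> undefined, which
    \<open>f\<close> cannot see.\<close>
  moreover have "?f \<circ> ?R (past k) = (\<lambda>\<omega>. f (\<lambda>s. a s \<omega>) (\<lambda>j. d j \<omega>))"
    unfolding comp_def by (intro ext f) (auto simp: past_def)
  moreover have "?g \<circ> ?R (present k) = (\<lambda>\<omega>. g (\<lambda>s. a s \<omega>) (\<lambda>j. d j \<omega>))"
    unfolding comp_def by (intro ext g) (auto simp: present_def)
  ultimately show ?thesis by simp
qed

lemma indep_X_VW:
  "indep_var (borel \<Otimes>\<^sub>M borel) (\<lambda>\<omega>. (X s0 k \<omega>, \<Sum>j<k. X s0 j \<omega>))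
     (borel \<Otimes>\<^sub>M borel) (\<lambda>\<omega>. (V k \<omega>, W k \<omega>))"
proof (rule indep_past_present)
  fix x x' :: "int \<Rightarrow> bool" and y y' :: "nat \<Rightarrow> bool"
  assume x: "\<And>s. - int m \<le> s \<Longrightarrow> s < (int k - 1) * int m \<Longrightarrow> x s = x' s"
    and y: "\<And>j. j < k \<Longrightarrow> y j = y' j"
  have "frame_age m s0 x y j = frame_age m s0 x' y' j" if "j \<le> k" for j
  proof (rule frame_age_cong[OF m])
    fix s assume "- int m \<le> s" "s < (int j - 1) * int m"
    moreover have "(int j - 1) * int m \<le> (int k - 1) * int m"
      using that by (intro mult_right_mono) auto
    ultimately show "x s = x' s" by (intro x) auto
  qed (use that y in auto)
  then show "(frame_age m s0 x y k, \<Sum>j<k. frame_age m s0 x y j) =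
      (frame_age m s0 x' y' k, \<Sum>j<k. frame_age m s0 x' y' j)"
    by (auto intro: sum.cong)
next
  fix x x' :: "int \<Rightarrow> bool" and y y' :: "nat \<Rightarrow> bool"
  assume x: "\<And>s. (int k - 1) * int m \<le> s \<Longrightarrow> s < int k * int m \<Longrightarrow> x s = x' s"
    and y: "y k = y' k"
  have idle: "idle m x k b = idle m x' k b" if "b \<le> m" for b
    using that x by (auto simp: idle_def left_diff_distrib)
  then have "(\<Sum>b<m. of_bool (idle m x k b)) = (\<Sum>b<m. of_bool (idle m x' k b) :: real)"
    by (intro sum.cong) auto
  then show "(of_bool (delivered m x y k), reset_age m x y k) =
      (of_bool (delivered m x' y' k), reset_age m x' y' k)"
    using y by (simp add: delivered_iff_idle reset_age_eq_idle idle)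
qed (auto simp: space_pair_measure)

lemma idle_slots_ge:
  assumes "b \<le> m" "s \<in> {int k * int m - int b..<int k * int m}"
  shows "s \<ge> - int m"
proof -
  have "0 \<le> int k * int m" by simp
  then show ?thesis using assms unfolding atLeastLessThan_iff by linarith
qed

lemma measurable_idle:
  assumes "b \<le> m"
  shows "(\<lambda>\<omega>. idle m (\<lambda>s. a s \<omega>) k b) \<in> measurable M (count_space UNIV)"
proof -
  have [measurable]: "s \<in> {int k * int m - int b..<int k * int m} \<Longrightarrow>
      a s \<in> measurable M (count_space UNIV)" for s
    using idle_slots_ge[OF assms] by (rule measurable_a)
  show ?thesis unfolding idle_def by measurable
qed

text \<open>The event is an intersection of \<open>b + 1\<close> independent ones: \<open>b\<close>
  silent slots and one decoding. Its indicator is a product over the index set \<open>I\<close>,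
  with factors given by \<open>h\<close>.\<close>

lemma expectation_idle_decoded:
  assumes b: "b \<le> m"
  shows "expectation (\<lambda>\<omega>. of_bool (d k \<omega>) * of_bool (idle m (\<lambda>s. a s \<omega>) k b)) =
    (1 - P\<^sub>l) * (1 - \<rho>) ^ b"
proof -
  define S where "S = {int k * int m - int b..<int k * int m}"
  define I :: "(int + nat) set" where "I = S <+> {k}"
  define h :: "int + nat \<Rightarrow> bool \<Rightarrow> real" where
    "h i x = (case i of Inl _ \<Rightarrow> of_bool (\<not> x) | Inr _ \<Rightarrow> of_bool x)" for i x
  have S: "s \<ge> - int m" if "s \<in> S" for s
    using idle_slots_ge[OF b] that unfolding S_def by blast
  have fin: "finite I" by (simp add: I_def S_def)
  have ind: "indep_vars (\<lambda>_. borel) (\<lambda>i \<omega>. h i (case_sum a d i \<omega>)) I"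
    by (rule indep_vars_compose2[OF indep_vars_subset[OF indep]]) (use S in \<open>auto simp: I_def\<close>)
  have h_Inl: "expectation (\<lambda>\<omega>. h (Inl s) (a s \<omega>)) = 1 - \<rho>" if "s \<in> S" for s
  proof -
    have meas[measurable]: "a s \<in> measurable M (count_space UNIV)"
      using S[OF that] by (rule measurable_a)
    have "expectation (\<lambda>\<omega>. h (Inl s) (a s \<omega>)) = \<P>(\<omega> in M. \<not> a s \<omega>)"
      unfolding h_def sum.case by (rule expectation_of_bool) measurable
    also have "\<dots> = 1 - \<P>(\<omega> in M. a s \<omega>)" by (rule prob_neg) measurable
    finally show ?thesis using prob_a S[OF that] by simp
  qed
  have h_Inr: "expectation (\<lambda>\<omega>. h (Inr k) (d k \<omega>)) = 1 - P\<^sub>l"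
    unfolding h_def sum.case by (subst expectation_of_bool) (auto simp: measurable_d prob_d)
  have prod: "(\<Prod>i\<in>I. F i) = (\<Prod>s\<in>S. F (Inl s)) * F (Inr k)" for F :: "int + nat \<Rightarrow> real"
    unfolding I_def by (subst prod.Plus) (auto simp: S_def)
  have "integrable M (\<lambda>\<omega>. h i (case_sum a d i \<omega>))" if "i \<in> I" for i
  proof (rule integrable_const_bound[where B = 1])
    show "(\<lambda>\<omega>. h i (case_sum a d i \<omega>)) \<in> borel_measurable M"
      using ind that unfolding indep_vars_def by blast
  qed (auto simp: h_def split: sum.split)
  from indep_vars_lebesgue_integral[OF fin ind this]
  have "expectation (\<lambda>\<omega>. (\<Prod>s\<in>S. of_bool (\<not> a s \<omega>)) * of_bool (d k \<omega>)) =
      (\<Prod>s\<in>S. expectation (\<lambda>\<omega>. h (Inl s) (a s \<omega>))) * expectation (\<lambda>\<omega>. h (Inr k) (d k \<omega>))"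
    unfolding prod by (simp add: h_def)
  also have "\<dots> = (1 - \<rho>) ^ b * (1 - P\<^sub>l)"
    by (simp add: h_Inl h_Inr) (simp add: S_def)
  also have "(\<lambda>\<omega>. (\<Prod>s\<in>S. of_bool (\<not> a s \<omega>)) * of_bool (d k \<omega>)) =
      (\<lambda>\<omega>. of_bool (d k \<omega>) * of_bool (idle m (\<lambda>s. a s \<omega>) k b) :: real)"
  proof
    fix \<omega>
    have "(\<Prod>s\<in>S. of_bool (\<not> a s \<omega>) :: real) = of_bool (\<forall>s\<in>S. \<not> a s \<omega>)"
      by (cases "\<forall>s\<in>S. \<not> a s \<omega>") (auto simp: S_def intro!: prod.neutral)
    then show "(\<Prod>s\<in>S. of_bool (\<not> a s \<omega>)) * of_bool (d k \<omega>) =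
        (of_bool (d k \<omega>) * of_bool (idle m (\<lambda>s. a s \<omega>) k b) :: real)"
      by (simp add: idle_def S_def mult.commute)
  qed
  finally show ?thesis by (simp add: mult.commute)
qed

lemma integrable_idle_decoded:
  assumes "b \<le> m"
  shows "integrable M (\<lambda>\<omega>. of_bool (d k \<omega>) * of_bool (idle m (\<lambda>s. a s \<omega>) k b) :: real)"
proof (rule integrable_const_bound[where B = 1])
  note [measurable] = measurable_idle[OF assms] measurable_d
  show "(\<lambda>\<omega>. of_bool (d k \<omega>) * of_bool (idle m (\<lambda>s. a s \<omega>) k b) :: real) \<in> borel_measurable M"
    by measurable
qed auto

lemma expectation_V: "expectation (V k) = (1 - (1 - \<rho>) ^ m) * (1 - P\<^sub>l)"
proof -
  \<comment> \<open>Since \<open>idle\<close> with \<open>b = 0\<close> always holds, the first term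
    is just the decoding indicator, written so that \<open>expectation_idle_decoded\<close> covers
    both terms.\<close>
  have V: "V k = (\<lambda>\<omega>. of_bool (d k \<omega>) * of_bool (idle m (\<lambda>s. a s \<omega>) k 0)
      - of_bool (d k \<omega>) * of_bool (idle m (\<lambda>s. a s \<omega>) k m))"
    by (auto simp: delivered_iff_idle idle_def)
  show ?thesis
    unfolding V
    by (subst Bochner_Integration.integral_diff)
      (auto simp: integrable_idle_decoded expectation_idle_decoded algebra_simps)
qed

text \<open>Taking expectations in \<open>reset_age_eq_idle\<close> leaves the geometric sum of
  \<open>(1 - \<rho>) ^ b\<close> over \<open>b < m\<close>, minus the correction for a silent
  frame.\<close>

lemma expectation_W:
  "expectation (W k) = ((1 - (1 - \<rho>) ^ m) / \<rho> - real m * (1 - \<rho>) ^ m) * (1 - P\<^sub>l)"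
proof -
  define h where "h b \<omega> = (of_bool (d k \<omega>) * of_bool (idle m (\<lambda>s. a s \<omega>) k b) :: real)" for b \<omega>
  have h: "integrable M (h b)" "expectation (h b) = (1 - P\<^sub>l) * (1 - \<rho>) ^ b" if "b \<le> m" for b
    unfolding h_def using that by (simp_all only: integrable_idle_decoded expectation_idle_decoded)
  have W: "W k = (\<lambda>\<omega>. (\<Sum>b<m. h b \<omega>) - real m * h m \<omega>)"
    unfolding reset_age_eq_idle h_def right_diff_distrib sum_distrib_left by (simp add: mult.left_commute)
  have "expectation (W k) = (\<Sum>b<m. (1 - P\<^sub>l) * (1 - \<rho>) ^ b) - real m * ((1 - P\<^sub>l) * (1 - \<rho>) ^ m)"
    unfolding W
  proof (subst Bochner_Integration.integral_diff)
    show "integrable M (\<lambda>\<omega>. \<Sum>b<m. h b \<omega>)"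
      by (intro Bochner_Integration.integrable_sum h) simp
    have "expectation (\<lambda>\<omega>. \<Sum>b<m. h b \<omega>) = (\<Sum>b<m. expectation (h b))"
      by (intro Bochner_Integration.integral_sum h) simp
    then show "expectation (\<lambda>\<omega>. \<Sum>b<m. h b \<omega>) - expectation (\<lambda>\<omega>. real m * h m \<omega>) =
        (\<Sum>b<m. (1 - P\<^sub>l) * (1 - \<rho>) ^ b) - real m * ((1 - P\<^sub>l) * (1 - \<rho>) ^ m)"
      by (simp add: h)
  qed (simp add: h)
  also have "(\<Sum>b<m. (1 - P\<^sub>l) * (1 - \<rho>) ^ b) = (1 - P\<^sub>l) * ((1 - (1 - \<rho>) ^ m) / \<rho>)"
    using \<rho> by (simp add: sum_distrib_left[symmetric] sum_gp_strict)
  finally show ?thesis by (simp add: algebra_simps)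
qed

definition mean_age :: real where
  "mean_age = real m / 2 + real m / ((1 - (1 - \<rho>) ^ m) * (1 - P\<^sub>l))
     + (1 / \<rho> - real m * (1 - \<rho>) ^ m / (1 - (1 - \<rho>) ^ m))"

text \<open>An instance of the reset chain with \<open>c = m\<close>, started at the age
  \<open>- s0\<close>, which lies above \<open>m\<close> and is at most
  \<open>2 * m\<close>.\<close>

lemma AE_time_average:
  assumes "s0 \<in> frame_slots m (- 2)"
  shows "AE \<omega> in M. (time_average (age m s0 (\<lambda>s. a s \<omega>) (\<lambda>k. d k \<omega>)) \<longlongrightarrow> mean_age) at_top"
proof -
  have s0: "- 2 * int m \<le> s0" "s0 < - int m" using assms by (auto simp: frame_slots_def)
  define q where "q = 1 - (1 - \<rho>) ^ m"
  have q: "0 < q"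
    using \<rho> m power_Suc_less_one[of "1 - \<rho>" "m - 1"] by (simp add: q_def)
  define \<xi> where "\<xi> = q * (1 - P\<^sub>l)"
  define \<beta> where "\<beta> = (q / \<rho> - real m * (1 - \<rho>) ^ m) * (1 - P\<^sub>l)"
  interpret reset_chain M "X s0" V W "real m" "- real_of_int s0" \<xi> \<beta>
  proof
    show "0 < \<xi>" unfolding \<xi>_def using q P\<^sub>l by simp
    show "- real_of_int s0 \<le> 2 * real m" using s0 by linarith
    show "0 \<le> - real_of_int s0" using s0 by linarith
    show "X s0 0 \<omega> = - real_of_int s0" for \<omega> by (rule frame_age_0[OF m])
    show "X s0 (Suc k) \<omega> = X s0 k \<omega> + real m - V k \<omega> * X s0 k \<omega> + W k \<omega>" for k \<omega>
      by (rule frame_age_Suc[OF m])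
  qed (use m in \<open>auto simp: reset_age_range indep_X_VW expectation_V expectation_W \<xi>_def \<beta>_def q_def\<close>)
  have "\<mu> = real m / \<xi> + \<beta> / \<xi>" by (simp add: \<mu>_def add_divide_distrib)
  \<comment> \<open>This quotient is the mean of \<open>B\<close> given a delivery; the decoding
    probability cancels.\<close>
  also have "\<beta> / \<xi> = 1 / \<rho> - real m * (1 - \<rho>) ^ m / q"
    using q P\<^sub>l \<rho> by (simp add: \<beta>_def \<xi>_def diff_divide_distrib)
  finally have mean: "mean_age = real m / 2 + \<mu>" by (simp add: mean_age_def \<xi>_def q_def)
  show ?thesis
    using AE_T_squares_tendsto
    by eventually_elim (unfold mean, use s0 m in \<open>auto simp: T_def intro!: time_average_age_tendsto\<close>)
qed

end

section \<open>The whole network\<close>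

theorem proposition2:
  fixes M :: "'w measure" and n m :: nat and \<rho> P\<^sub>l :: real
    and A :: "nat \<Rightarrow> int \<Rightarrow> 'w \<Rightarrow> bool" and D :: "nat \<Rightarrow> nat \<Rightarrow> 'w \<Rightarrow> bool"
    and s0 :: "nat \<Rightarrow> 'w \<Rightarrow> int"
  assumes "n \<ge> 1" and "m \<ge> 1" and "0 < \<rho>" and "\<rho> < 1" and "0 \<le> P\<^sub>l" and "P\<^sub>l < 1"
    and "irsa_network M n m \<rho> P\<^sub>l A D s0"
  shows "AE \<omega> in M.
    (\<forall>i \<in> {1..n}. \<exists>L. (time_average (node_age m A D s0 \<omega> i) \<longlongrightarrow> L) at_top) \<and>
    network_average_age n (node_age m A D s0 \<omega>) =
      real m / 2 + real n / throughput n m \<rho> P\<^sub>l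
        + (1 / \<rho> - real m * (1 - \<rho>) ^ m / (1 - (1 - \<rho>) ^ m))"
proof -
  interpret irsa_network M n m \<rho> P\<^sub>l A D s0 by fact
  define \<mu> where "\<mu> = irsa_node.mean_age m \<rho> P\<^sub>l"
  have node: "irsa_node M m \<rho> P\<^sub>l (A i) (D i)" if "i \<in> {1..n}" for i
    using that assms activity_prob decoding_prob node_indep by unfold_locales auto
  have \<mu>: "\<mu> = real m / 2 + real n / throughput n m \<rho> P\<^sub>l
        + (1 / \<rho> - real m * (1 - \<rho>) ^ m / (1 - (1 - \<rho>) ^ m))"
    \<comment> \<open>Node 1 exists and gives access to the closed form of the mean; there
      \<open>m / \<xi>\<close> equals \<open>n\<close> divided by the throughput.\<close>
    using irsa_node.mean_age_def[OF node[of 1]] \<open>n \<ge> 1\<close>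
    by (simp add: \<mu>_def throughput_def channel_load_def)
  \<comment> \<open>Finitely many almost sure events, one for each node and each possible stamp,
    hold simultaneously. Afterwards \<open>s\<close> can be replaced by the random
    \<open>s0 i \<omega>\<close>, however it depends on the rest.\<close>
  have "AE \<omega> in M. \<forall>i\<in>{1..n}. \<forall>s\<in>frame_slots m (- 2).
      (time_average (age m s (\<lambda>s. A i s \<omega>) (\<lambda>k. D i k \<omega>)) \<longlongrightarrow> \<mu>) at_top"
    unfolding \<mu>_def
    by (intro AE_finite_allI) (auto simp: frame_slots_def intro: irsa_node.AE_time_average[OF node])
  then show ?thesis
    using AE_space
  proof eventually_elim
    case (elim \<omega>)
    have lim: "(time_average (node_age m A D s0 \<omega> i) \<longlongrightarrow> \<mu>) at_top" if "i \<in> {1..n}" for i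
      using elim that initial_stamp_range by (auto simp: node_age_def)
    then have "average_age (node_age m A D s0 \<omega> i) = \<mu>" if "i \<in> {1..n}" for i
      unfolding average_age_def using that by (intro tendsto_Lim) auto
    then have "network_average_age n (node_age m A D s0 \<omega>) = \<mu>"
      using \<open>n \<ge> 1\<close> by (simp add: network_average_age_def)
    with lim show ?case unfolding \<mu> by blast
  qed
qed

end
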